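(* There exists a tile set $\tau$ such that $\tau$-tilings of the plane exist and every $\tau$-tiling is $\alpha$-aperiodic for every $\alpha<1/4$.
   Context: A tile set is a finite subset $\tau\subset C^4$ for a finite color set $C$; a $\tau$-tiling of the plane is a map $U\colon\mathbb{Z}^2\to\tau$ in which adjacent tiles have equal colors on their common side. For a real $\alpha>0$, a map $U\colon\mathbb{Z}^2\to A$ (any finite alphabet $A$, e.g. $A=\tau$) is $\alpha$-aperiodic if for every nonzero vector $T\in\mathbb{Z}^2$ there exists $N$ such that in every square of side at least $N$ the fraction of points $x$ with $U(x)\ne U(x+T)$ exceeds $\alpha$. *)

theory Defs
  imports Complex_Main
begin

type_synonym 'c tile = "'c \<times> 'c \<times> 'c \<times> 'c"

definition north :: "'c tile \<Rightarrow> 'c" where "north t = fst t"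
definition east  :: "'c tile \<Rightarrow> 'c" where "east t = fst (snd t)"
definition south :: "'c tile \<Rightarrow> 'c" where "south t = fst (snd (snd t))"
definition west  :: "'c tile \<Rightarrow> 'c" where "west t = snd (snd (snd t))"

text \<open>A tile set is a finite set of tiles (the colours used then form a finite set).\<close>
definition tile_set :: "'c tile set \<Rightarrow> bool" where
  "tile_set \<tau> \<longleftrightarrow> finite \<tau>"

definition tiling :: "'c tile set \<Rightarrow> (int \<times> int \<Rightarrow> 'c tile) \<Rightarrow> bool" where
  "tiling \<tau> U \<longleftrightarrow> (\<forall>x y. U (x, y) \<in> \<tau>
      \<and> east (U (x, y)) = west (U (x + 1, y))
      \<and> north (U (x, y)) = south (U (x, y + 1)))"

definition square :: "int \<times> int \<Rightarrow> nat \<Rightarrow> (int \<times> int) set" where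
  "square p n = {fst p ..< fst p + int n} \<times> {snd p ..< snd p + int n}"

definition aperiodic :: "real \<Rightarrow> (int \<times> int \<Rightarrow> 'a) \<Rightarrow> bool" where
  "aperiodic \<alpha> U \<longleftrightarrow>
     (\<forall>T. T \<noteq> (0, 0) \<longrightarrow>
        (\<exists>N. \<forall>n \<ge> N. \<forall>p.
           real (card {x \<in> square p n. U x \<noteq> U (fst x + fst T, snd x + snd T)})
             > \<alpha> * real (card (square p n))))"

end

theory Submission
  imports Defs "HOL-Library.Countable"
begin

text \<open>The tile set is a variant of Robinson's. Call a column or row of index
  \<open>2^k (2m+1)\<close> of level \<open>k\<close>. Where a column and a row of equal level meet there is a cross, which
  emits four arrows; each arrow runs until it meets a line of higher level. The local rules are
  preserved when every second row and column is deleted, so a tiling carries crosses of all levels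
  with the crosses of level \<open>k\<close> at the corners of squares centred at the crosses of level \<open>k+1\<close>.
  Each cross holds a bit, and an arrow leaving the centre of a square through the middle of a side
  forces the bits at the corners to be those of the two-dimensional Thue--Morse substitution
  applied to the bit at the centre.

  The bits on the crosses of level 0 are therefore an infinitely desubstitutable array. The mismatch
  density of such an array under a shift \<open>T\<close> is the mean of four mismatch densities under shifts
  of half the size, complemented if the coordinates of \<open>T\<close> have an odd sum. Iterating this down to
  shifts with entries in \<open>{-1, 0, 1}\<close> shows that for \<open>T \<noteq> 0\<close> the density is between
  \<open>1/4\<close> and \<open>3/4\<close>. Finally every tile shows the parity of its position, and the bit of the
  level 0 cross of its \<open>2 \<times> 2\<close> block: an odd shift changes every tile, and an even one changes at least
  a quarter of them.\<close>

subsection \<open>Local rules and renormalisation\<close>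

text \<open>A mark sits on an edge of the grid that is crossed by an arrow. The field \<open>dir\<close> is true if the
  arrow points east or north; \<open>hor\<close>, \<open>ver\<close> and \<open>bit\<close> are copied from the cross that emits the arrow:
  \<open>hor\<close> (\<open>ver\<close>) is true if the cross is a right (upper) corner of its square. The \<open>phase\<close> records
  whether the arrow has left the square around its source.\<close>

datatype mark = Mark (dir: bool) (phase: bool) (hor: bool) (ver: bool) (bit: bool)

instance mark :: countable
  by countable_datatype

instance mark :: finite
proof
  have "(UNIV :: mark set) = (\<lambda>(d, p, h, v, c). Mark d p h v c) ` UNIV"
  proof (intro set_eqI iffI UNIV_I)
    fix z :: mark
    show "z \<in> (\<lambda>(d, p, h, v, c). Mark d p h v c) ` UNIV"
      by (rule image_eqI[of _ _ "(dir z, phase z, hor z, ver z, bit z)"]) auto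
  qed
  then show "finite (UNIV :: mark set)"
    by (metis finite finite_imageI)
qed

text \<open>Reflection in the diagonal: east and north are exchanged, so \<open>dir\<close>
  survives.\<close>

fun flip :: "mark \<Rightarrow> mark" where
  "flip (Mark d p h v c) = Mark d p v h c"

lemma flip_sel [simp]:
  "dir (flip z) = dir z" "phase (flip z) = phase z" "hor (flip z) = ver z"
  "ver (flip z) = hor z" "bit (flip z) = bit z"
  by (cases z; simp)+

lemma flip_flip [simp]: "flip (flip z) = z"
  by (cases z) simp

definition cross :: "bool \<Rightarrow> mark \<Rightarrow> mark \<Rightarrow> mark \<Rightarrow> mark \<Rightarrow> bool" where
  "cross q n e s w \<longleftrightarrow> (\<exists>h v c. n = Mark True q h v c \<and> e = Mark True q h v c \<and>
     s = Mark False q h v c \<and> w = Mark False q h v c)"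

text \<open>The flag \<open>i\<close> says that the arrow crosses the middle of a side of the square around its source.\<close>

definition pass :: "bool \<Rightarrow> mark \<Rightarrow> mark \<Rightarrow> bool" where
  "pass i s n \<longleftrightarrow> dir n = dir s \<and> hor n = hor s \<and> ver n = ver s \<and> bit n = bit s \<and>
     (if i then phase s = (\<not> dir s) \<and> phase n = dir s else phase n = phase s)"

lemma pass_flip [simp]: "pass i (flip s) (flip n) = pass i s n"
  by (auto simp: pass_def)

text \<open>The arrows \<open>w\<close> and \<open>e\<close> collide in a column of higher level. If
  \<open>w\<close> comes from a left corner, the vertical arrow crosses the middle of a side; the
  last conjunct is then the substitution, which negates the bit at the upper left and lower right
  corners.\<close>

definition column_cell :: "mark \<Rightarrow> mark \<Rightarrow> mark \<Rightarrow> mark \<Rightarrow> bool" where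
  "column_cell w e s n \<longleftrightarrow> dir w \<and> phase w \<and> \<not> dir e \<and> phase e \<and>
     hor e = (\<not> hor w) \<and> ver e = ver w \<and> pass (\<not> hor w) s n \<and>
     (\<not> hor w \<longrightarrow> bit w = (bit s \<noteq> ver w) \<and> bit e = (bit s = ver w))"

definition row_cell :: "mark \<Rightarrow> mark \<Rightarrow> mark \<Rightarrow> mark \<Rightarrow> bool" where
  "row_cell s n w e \<longleftrightarrow> column_cell (flip s) (flip n) (flip w) (flip e)"

text \<open>\<open>A\<close> and \<open>B\<close> say that the column and the row, respectively, are of level 0. An arrow of level 0
  ends next to its source and crosses no side, hence starts with phase \<^term>\<open>True\<close>.\<close>

definition cell :: "bool \<Rightarrow> bool \<Rightarrow> mark \<Rightarrow> mark \<Rightarrow> mark \<Rightarrow> mark \<Rightarrow> bool" where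
  "cell A B n e s w \<longleftrightarrow> A = B \<and> cross A n e s w \<or> \<not> A \<and> column_cell w e s n \<or>
     \<not> B \<and> row_cell s n w e"

lemma cell_flip: "cell B A (flip e) (flip n) (flip w) (flip s) \<longleftrightarrow> cell A B n e s w"
proof -
  have "cross B (flip e) (flip n) (flip w) (flip s) \<longleftrightarrow> cross B n e s w"
    unfolding cross_def by (cases n; cases e; cases s; cases w) auto
  then show ?thesis
    unfolding cell_def row_cell_def by auto
qed

text \<open>\<open>N x y\<close> and \<open>E x y\<close> are the marks on the upper and right edges
  of the cell \<open>(x, y)\<close>.\<close>

definition conf ::
  "(int \<Rightarrow> bool) \<Rightarrow> (int \<Rightarrow> bool) \<Rightarrow> (int \<Rightarrow> int \<Rightarrow> mark) \<Rightarrow> (int \<Rightarrow> int \<Rightarrow> mark) \<Rightarrow> bool" where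
  "conf a b N E \<longleftrightarrow> (\<forall>x y. cell (a x) (b y) (N x y) (E x y) (N x (y - 1)) (E (x - 1) y))"

lemma conf_flip:
  assumes "conf a b N E"
  shows "conf b a (\<lambda>x y. flip (E y x)) (\<lambda>x y. flip (N y x))"
  using assms unfolding conf_def by (simp add: cell_flip)

section \<open>Arrangement of the level 0 crosses\<close>

lemma alternating_int:
  fixes P :: "int \<Rightarrow> bool"
  assumes "\<And>m. P (m + 1) = (\<not> P m)"
  shows "P m = (P 0 \<noteq> odd m)"
proof (induction m rule: int_induct[where k = 0])
  case (step2 i)
  then show ?case using assms[of "i - 1"] by auto
qed (use assms in auto)

lemma constant_int:
  fixes P :: "int \<Rightarrow> 'a"
  assumes "\<And>m. P (m + 1) = P m"
  shows "P m = P 0"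
proof (induction m rule: int_induct[where k = 0])
  case (step2 i)
  then show ?case using assms[of "i - 1"] by auto
qed (use assms in auto)

lemma odd_cells:
  assumes "conf odd odd N E"
  shows odd_odd_cell:
      "cross True (N (2*m-1) (2*n-1)) (E (2*m-1) (2*n-1)) (N (2*m-1) (2*n-2)) (E (2*m-2) (2*n-1))"
    and even_odd_cell:
      "column_cell (E (2*m-1) (2*n-1)) (E (2*m) (2*n-1)) (N (2*m) (2*n-2)) (N (2*m) (2*n-1))"
    and odd_even_cell:
      "row_cell (N (2*m-1) (2*n-1)) (N (2*m-1) (2*n)) (E (2*m-2) (2*n)) (E (2*m-1) (2*n))"
  using assms[unfolded conf_def, rule_format, of "2*m-1" "2*n-1"]
    assms[unfolded conf_def, rule_format, of "2*m" "2*n-1"]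
    assms[unfolded conf_def, rule_format, of "2*m-1" "2*n"]
  by (simp_all add: cell_def)

lemma odd_odd_sel:
  assumes "conf odd odd N E"
  shows "hor (E (2*m-2) (2*n-1)) = hor (E (2*m-1) (2*n-1))"
    "bit (E (2*m-2) (2*n-1)) = bit (E (2*m-1) (2*n-1))"
    "hor (N (2*m-1) (2*n-1)) = hor (E (2*m-1) (2*n-1))"
    "hor (N (2*m-1) (2*n-2)) = hor (E (2*m-1) (2*n-1))"
    "ver (N (2*m-1) (2*n-1)) = ver (E (2*m-1) (2*n-1))"
  using odd_odd_cell[OF assms, of m n] by (auto simp: cross_def)

text \<open>Neighbouring crosses in a row send arrows into a common column cell, which negates
  \<open>hor\<close>; those in a column meet in a row cell, which preserves it.\<close>

lemma odd_hor:
  assumes "conf odd odd N E"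
  shows "hor (E (2*m-1) (2*n-1)) = (hor (E (-1) (-1)) \<noteq> odd m)"
proof -
  have "hor (E (2*(m+1)-1) (2*n-1)) = (\<not> hor (E (2*m-1) (2*n-1)))" for m n
  proof -
    have "hor (E (2*m) (2*n-1)) = (\<not> hor (E (2*m-1) (2*n-1)))"
      using even_odd_cell[OF assms, of m n] unfolding column_cell_def by blast
    then show ?thesis
      using odd_odd_sel(1)[OF assms, of "m+1" n] by simp
  qed
  then have 1: "hor (E (2*m-1) (2*n-1)) = (hor (E (-1) (2*n-1)) \<noteq> odd m)" for m n
    using alternating_int[of "\<lambda>m. hor (E (2*m-1) (2*n-1))" m] by simp
  have "hor (E (-1) (2*(n+1)-1)) = hor (E (-1) (2*n-1))" for n
  proof -
    have "hor (N (-1) (2*n)) = hor (N (-1) (2*n-1))"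
      using odd_even_cell[OF assms, of 0 n] unfolding row_cell_def column_cell_def flip_sel by simp
    then show ?thesis
      using odd_odd_sel(3)[OF assms, of 0 n] odd_odd_sel(4)[OF assms, of 0 "n+1"] by simp
  qed
  then have "hor (E (-1) (2*n-1)) = hor (E (-1) (-1))" for n
    using constant_int[of "\<lambda>n. hor (E (-1) (2*n-1))" n] by simp
  with 1 show ?thesis by simp
qed

lemma odd_ver:
  assumes "conf odd odd N E"
  shows "ver (E (2*m-1) (2*n-1)) = (ver (E (-1) (-1)) \<noteq> odd n)"
proof -
  note 1 = odd_odd_sel(5)[OF assms]
  show ?thesis
    using odd_hor[OF conf_flip[OF assms], where m = n and n = m] 1[of m n] 1[of 0 0] by simp
qed

text \<open>The deleted cell between two neighbours at the coarse scale may change the phase; the coarse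
  mark is the one behind it, on the half of the edge where the arrow arrives.\<close>

definition coarse_E :: "(int \<Rightarrow> int \<Rightarrow> mark) \<Rightarrow> int \<Rightarrow> int \<Rightarrow> mark" where
  "coarse_E E m n = (if dir (E (2*m) (2*n)) then E (2*m+1) (2*n) else E (2*m) (2*n))"

definition coarse_N :: "(int \<Rightarrow> int \<Rightarrow> mark) \<Rightarrow> int \<Rightarrow> int \<Rightarrow> mark" where
  "coarse_N N m n = (if dir (N (2*m) (2*n)) then N (2*m) (2*n+1) else N (2*m) (2*n))"

text \<open>A left corner just left of column \<open>2*m\<close> means that the column runs through
  the middle of squares of level 0 crosses. By \<open>odd_hor\<close> any odd row could replace
  -1.\<close>

definition coarse_a :: "(int \<Rightarrow> int \<Rightarrow> mark) \<Rightarrow> int \<Rightarrow> bool" where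
  "coarse_a E m \<longleftrightarrow> \<not> hor (E (2*m-1) (-1))"

definition coarse_b :: "(int \<Rightarrow> int \<Rightarrow> mark) \<Rightarrow> int \<Rightarrow> bool" where
  "coarse_b E n \<longleftrightarrow> \<not> ver (E (-1) (2*n-1))"

lemma coarse_ab:
  assumes "conf odd odd N E"
  shows "hor (E (2*m-1) (2*n-1)) = (\<not> coarse_a E m)"
    and "ver (E (2*m-1) (2*n-1)) = (\<not> coarse_b E n)"
    and "coarse_a E (m + 1) = (\<not> coarse_a E m)"
    and "coarse_b E (n + 1) = (\<not> coarse_b E n)"
  using odd_hor[OF assms, of m n] odd_hor[OF assms, of m 0] odd_hor[OF assms, of "m+1" 0]
    odd_ver[OF assms, of m n] odd_ver[OF assms, of 0 n] odd_ver[OF assms, of 0 "n+1"]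
  by (auto simp: coarse_a_def coarse_b_def)

text \<open>The cell deleted between the coarse cells \<open>(m, n)\<close> and
  \<open>(m, n+1)\<close> is a column cell.\<close>

lemma pass_N:
  assumes "conf odd odd N E"
  shows "pass (coarse_a E m) (N (2*m) (2*n)) (N (2*m) (2*n+1))"
  using even_odd_cell[OF assms, of m "n+1"] coarse_ab(1)[OF assms, of m "n+1"]
  by (simp add: column_cell_def add.commute)

lemma pass_E:
  assumes "conf odd odd N E"
  shows "pass (coarse_b E n) (E (2*m) (2*n)) (E (2*m+1) (2*n))"
proof -
  have eq: "2*(m+1)-1 = 2*m+1" "2*(m+1)-2 = 2*m" by simp_all
  have "pass (\<not> ver (N (2*m+1) (2*n-1))) (E (2*m) (2*n)) (E (2*m+1) (2*n))"
    using odd_even_cell[OF assms, of "m+1" n]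
    unfolding row_cell_def column_cell_def eq flip_sel pass_flip by blast
  then show ?thesis
    using odd_odd_sel(5)[OF assms, of "m+1" n] coarse_ab(2)[OF assms, of "m+1" n]
    unfolding eq by simp
qed

lemma even_cell:
  assumes "conf odd odd N E"
  shows "cell False False (N (2*m) (2*n)) (E (2*m) (2*n)) (N (2*m) (2*n-1)) (E (2*m-1) (2*n))"
  using assms[unfolded conf_def, rule_format, of "2*m" "2*n"] by simp

text \<open>An arrow changes its phase at most once. In a column that is of level 0 at the coarse scale the
  arrows do so in every second cell, so no arrow runs through the cell in between.\<close>

lemma no_three_passes: "\<lbrakk>pass True r s; pass i s t; pass True t u\<rbrakk> \<Longrightarrow> False"
  by (cases i) (simp_all add: pass_def)

lemma not_column_cell:
  assumes "conf odd odd N E" "coarse_a E m"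
  shows "\<not> column_cell (E (2*m-1) (2*n)) (E (2*m) (2*n)) (N (2*m) (2*n-1)) (N (2*m) (2*n))"
proof
  assume "column_cell (E (2*m-1) (2*n)) (E (2*m) (2*n)) (N (2*m) (2*n-1)) (N (2*m) (2*n))"
  then have "pass (\<not> hor (E (2*m-1) (2*n))) (N (2*m) (2*n-1)) (N (2*m) (2*n))"
    unfolding column_cell_def by blast
  moreover have "pass True (N (2*m) (2*n)) (N (2*m) (2*n+1))"
    "pass True (N (2*m) (2*n-2)) (N (2*m) (2*n-1))"
    using pass_N[OF assms(1), of m n] pass_N[OF assms(1), of m "n-1"] assms(2) by simp_all
  ultimately show False
    using no_three_passes by blast
qed

lemma not_row_cell:
  assumes "conf odd odd N E" "coarse_b E n"
  shows "\<not> row_cell (N (2*m) (2*n-1)) (N (2*m) (2*n)) (E (2*m-1) (2*n)) (E (2*m) (2*n))"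
proof
  assume "row_cell (N (2*m) (2*n-1)) (N (2*m) (2*n)) (E (2*m-1) (2*n)) (E (2*m) (2*n))"
  then have "pass (\<not> ver (N (2*m) (2*n-1))) (E (2*m-1) (2*n)) (E (2*m) (2*n))"
    unfolding row_cell_def column_cell_def by (simp add: pass_flip)
  moreover have "pass True (E (2*m) (2*n)) (E (2*m+1) (2*n))"
    "pass True (E (2*m-2) (2*n)) (E (2*m-1) (2*n))"
    using pass_E[OF assms(1), of n m] pass_E[OF assms(1), of n "m-1"] assms(2) by simp_all
  ultimately show False
    using no_three_passes by blast
qed

lemma pass_dir: "pass i s n \<Longrightarrow> dir n = dir s"
  by (simp add: pass_def)

lemma cross_dir: "cross q n e s w \<Longrightarrow> dir n \<and> dir e \<and> \<not> dir s \<and> \<not> dir w"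
  by (auto simp: cross_def)

lemma leaf_leaf_cross:
  assumes "conf odd odd N E" "coarse_a E m" "coarse_b E n"
  shows "cross False (N (2*m) (2*n)) (E (2*m) (2*n)) (N (2*m) (2*n-1)) (E (2*m-1) (2*n))"
  using even_cell[OF assms(1), of m n] not_column_cell[OF assms(1,2), of n]
    not_row_cell[OF assms(1,3), of m] unfolding cell_def by blast

text \<open>Otherwise, as coarse levels alternate, the next even cell above or to the right has
  column and row of coarse level 0 and is a cross. The two crosses would send opposite arrows
  through the deleted cell between them.\<close>

lemma even_cross_coarse:
  assumes "conf odd odd N E"
    and "cross False (N (2*m) (2*n)) (E (2*m) (2*n)) (N (2*m) (2*n-1)) (E (2*m-1) (2*n))"
  shows "coarse_a E m = coarse_b E n"
proof (rule ccontr)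
  assume ne: "coarse_a E m \<noteq> coarse_b E n"
  have eq: "2*(k+1)-1 = 2*k+1" for k :: int by simp
  consider "coarse_a E m" "coarse_b E (n + 1)" | "coarse_a E (m + 1)" "coarse_b E n"
    using ne coarse_ab(3,4)[OF assms(1)] by blast
  then show False
  proof cases
    case 1
    from cross_dir[OF leaf_leaf_cross[OF assms(1) 1]] have "\<not> dir (N (2*m) (2*n+1))"
      unfolding eq by blast
    then show False
      using cross_dir[OF assms(2)] pass_dir[OF pass_N[OF assms(1), of m n]] by blast
  next
    case 2
    from cross_dir[OF leaf_leaf_cross[OF assms(1) 2]] have "\<not> dir (E (2*m+1) (2*n))"
      unfolding eq by blast
    then show False
      using cross_dir[OF assms(2)] pass_dir[OF pass_E[OF assms(1), of n m]] by blast
  qed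
qed

lemma pass_False_iff: "pass False s n \<longleftrightarrow> n = s"
  by (cases s; cases n) (auto simp: pass_def)

lemma pass_source:
  "pass i (Mark True False h v c) z \<Longrightarrow> z = Mark True i h v c"
  "pass i z (Mark False False h v c) \<Longrightarrow> z = Mark False i h v c"
  by (cases z; simp add: pass_def split: if_splits)+

text \<open>Each kind of even cell survives. A cross emits phase False, which the adjacent deleted
  cells turn into True exactly at coarse level 0. Arrows running through a cell keep their marks
  because their line is not of coarse level 0, and colliding arrows are read off next to the
  cell.\<close>

lemma coarse_conf:
  assumes "conf odd odd N E"
  shows "conf (coarse_a E) (coarse_b E) (coarse_N N) (coarse_E E)"
  unfolding conf_def
proof (intro allI)
  fix m n
  let ?n = "N (2*m) (2*n)" and ?e = "E (2*m) (2*n)"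
  let ?s = "N (2*m) (2*n-1)" and ?w = "E (2*m-1) (2*n)"
  have P: "pass (coarse_a E m) ?n (N (2*m) (2*n+1))"
    "pass (coarse_a E m) (N (2*m) (2*n-2)) ?s"
    "pass (coarse_b E n) ?e (E (2*m+1) (2*n))"
    "pass (coarse_b E n) (E (2*m-2) (2*n)) ?w"
    using pass_N[OF assms, of m n] pass_N[OF assms, of m "n-1"]
      pass_E[OF assms, of n m] pass_E[OF assms, of n "m-1"] by simp_all
  have D: "coarse_N N m n = (if dir ?n then N (2*m) (2*n+1) else ?n)"
    "coarse_N N m (n-1) = (if dir (N (2*m) (2*n-2)) then ?s else N (2*m) (2*n-2))"
    "coarse_E E m n = (if dir ?e then E (2*m+1) (2*n) else ?e)"
    "coarse_E E (m-1) n = (if dir (E (2*m-2) (2*n)) then ?w else E (2*m-2) (2*n))"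
    by (simp_all add: coarse_N_def coarse_E_def)
  consider "cross False ?n ?e ?s ?w" | "column_cell ?w ?e ?s ?n" | "row_cell ?s ?n ?w ?e"
    using even_cell[OF assms, of m n] by (auto simp: cell_def)
  then show "cell (coarse_a E m) (coarse_b E n) (coarse_N N m n) (coarse_E E m n)
      (coarse_N N m (n-1)) (coarse_E E (m-1) n)"
  proof cases
    case 1
    note ab = even_cross_coarse[OF assms 1]
    obtain h v c where M: "?n = Mark True False h v c" "?e = Mark True False h v c"
      "?s = Mark False False h v c" "?w = Mark False False h v c"
      using 1 by (auto simp: cross_def)
    then have "coarse_N N m n = Mark True (coarse_a E m) h v c"
      "coarse_E E m n = Mark True (coarse_a E m) h v c"
      "coarse_N N m (n-1) = Mark False (coarse_a E m) h v c"
      "coarse_E E (m-1) n = Mark False (coarse_a E m) h v c"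
      using P[THEN pass_dir] P(1,3)[unfolded M, THEN pass_source(1)]
        P(2,4)[unfolded M, THEN pass_source(2)] ab
      unfolding D by (simp_all add: M)
    then have "cross (coarse_a E m) (coarse_N N m n) (coarse_E E m n)
        (coarse_N N m (n-1)) (coarse_E E (m-1) n)"
      by (auto simp: cross_def)
    then show ?thesis using ab by (simp add: cell_def)
  next
    case 2
    have a: "\<not> coarse_a E m"
      using 2 not_column_cell[OF assms] by blast
    have "coarse_N N m n = ?n" "coarse_N N m (n-1) = ?s"
      using P(1,2) a unfolding D by (simp_all add: pass_False_iff)
    moreover have "coarse_E E m n = ?e" "coarse_E E (m-1) n = ?w"
      using 2 P(3,4)[THEN pass_dir] unfolding D column_cell_def by simp_all
    ultimately have "column_cell (coarse_E E (m-1) n) (coarse_E E m n) (coarse_N N m (n-1)) (coarse_N N m n)"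
      using 2 by simp
    then show ?thesis using a by (simp add: cell_def)
  next
    case 3
    have b: "\<not> coarse_b E n"
      using 3 not_row_cell[OF assms] by blast
    have "coarse_E E m n = ?e" "coarse_E E (m-1) n = ?w"
      using P(3,4) b unfolding D by (simp_all add: pass_False_iff)
    moreover have "coarse_N N m n = ?n" "coarse_N N m (n-1) = ?s"
      using 3 P(1,2)[THEN pass_dir] unfolding D row_cell_def column_cell_def by simp_all
    ultimately have "row_cell (coarse_N N m (n-1)) (coarse_N N m n) (coarse_E E (m-1) n) (coarse_E E m n)"
      using 3 by simp
    then show ?thesis using b by (simp add: cell_def)
  qed
qed

text \<open>The vertical arrows of the even cross reach the lower and upper sides of its square, and
  the column cells there force the bits of the four corners.\<close>

lemma coarse_bit:
  assumes "conf odd odd N E" "coarse_a E m" "coarse_b E n"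
  defines "c \<equiv> \<lambda>m n. bit (E (2*m-1) (2*n-1))"
  shows "c m n = bit (coarse_E E m n)" "c (m+1) n = (\<not> bit (coarse_E E m n))"
    "c m (n+1) = (\<not> bit (coarse_E E m n))" "c (m+1) (n+1) = bit (coarse_E E m n)"
proof -
  have cr: "cross False (N (2*m) (2*n)) (E (2*m) (2*n)) (N (2*m) (2*n-1)) (E (2*m-1) (2*n))"
    using leaf_leaf_cross[OF assms(1-3)] .
  have 0: "bit (coarse_E E m n) = bit (N (2*m) (2*n))" "bit (N (2*m) (2*n-1)) = bit (N (2*m) (2*n))"
    using cr pass_E[OF assms(1), of n m] by (auto simp: coarse_E_def cross_def pass_def)
  have r: "bit (E (2*m) (2*k-1)) = c (m+1) k" for k
    using odd_odd_sel(2)[OF assms(1), of "m+1" k] by (simp add: c_def)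
  show "c m n = bit (coarse_E E m n)" "c (m+1) n = (\<not> bit (coarse_E E m n))"
    using even_odd_cell[OF assms(1), of m n] coarse_ab(1,2)[OF assms(1), of m n] assms(2,3) 0
      r[of n]
    by (auto simp: column_cell_def c_def pass_def)
  show "c m (n+1) = (\<not> bit (coarse_E E m n))" "c (m+1) (n+1) = bit (coarse_E E m n)"
    using even_odd_cell[OF assms(1), of m "n+1"] coarse_ab(1,2)[OF assms(1), of m "n+1"] assms(2,3) 0
      r[of "n+1"] coarse_ab(4)[OF assms(1), of n]
    by (auto simp: column_cell_def c_def pass_def)
qed

section \<open>Desubstitution of the array of level 0 bits\<close>

definition leaf_bits :: "(int \<Rightarrow> int \<Rightarrow> bool) \<Rightarrow> bool" where
  "leaf_bits c \<longleftrightarrow> (\<exists>N E. conf odd odd N E \<and> c = (\<lambda>m n. bit (E (2*m-1) (2*n-1))))"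

lemma leaf_bits_desubstitute:
  assumes "leaf_bits c"
  obtains c' r s where "leaf_bits c'"
    "\<And>m n i j. i \<in> {0, 1} \<Longrightarrow> j \<in> {0, 1} \<Longrightarrow> c (2*m+r+i) (2*n+s+j) = (c' m n \<noteq> odd (i + j))"
proof -
  obtain N E where conf: "conf odd odd N E" and c: "c = (\<lambda>m n. bit (E (2*m-1) (2*n-1)))"
    using assms by (auto simp: leaf_bits_def)
  \<comment> \<open>Coarse level 0 may fall on the even indices; the shift moves it to the odd
    ones.\<close>
  define r :: int where "r = (if coarse_a E 0 then 1 else 0)"
  define s :: int where "s = (if coarse_b E 0 then 1 else 0)"
  have a: "coarse_a E (m - r) = odd m" for m
    using alternating_int[of "coarse_a E" "m - r"] coarse_ab(3)[OF conf] by (auto simp: r_def)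
  have b: "coarse_b E (n - s) = odd n" for n
    using alternating_int[of "coarse_b E" "n - s"] coarse_ab(4)[OF conf] by (auto simp: s_def)
  define N' where "N' m n = coarse_N N (m - r) (n - s)" for m n
  define E' where "E' m n = coarse_E E (m - r) (n - s)" for m n
  have "conf odd odd N' E'"
    unfolding conf_def
  proof (intro allI)
    fix x y
    show "cell (odd x) (odd y) (N' x y) (E' x y) (N' x (y-1)) (E' (x-1) y)"
      using coarse_conf[OF conf, unfolded conf_def, rule_format, of "x - r" "y - s"]
      by (simp add: a b N'_def E'_def algebra_simps)
  qed
  then have "leaf_bits (\<lambda>m n. bit (E' (2*m-1) (2*n-1)))"
    by (auto simp: leaf_bits_def)
  moreover have "c (2*m+(-1-r)+i) (2*n+(-1-s)+j) = (bit (E' (2*m-1) (2*n-1)) \<noteq> odd (i + j))"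
    if "i \<in> {0, 1}" "j \<in> {0, 1}" for m n i j
  proof -
    define p q where "p = 2*m-1-r" and "q = 2*n-1-s"
    have "coarse_a E p" "coarse_b E q"
      using a[of "2*m-1"] b[of "2*n-1"] by (simp_all add: p_def q_def)
    note * = coarse_bit[OF conf this]
    have "c (p + i) (q + j) = (bit (coarse_E E p q) \<noteq> odd (i + j))"
      unfolding c using that * by (elim insertE emptyE) simp_all
    moreover have "2*m+(-1-r)+i = p + i" "2*n+(-1-s)+j = q + j" "E' (2*m-1) (2*n-1) = coarse_E E p q"
      by (simp_all add: p_def q_def E'_def)
    ultimately show ?thesis by simp
  qed
  ultimately show ?thesis by (rule that)
qed


subsection \<open>Mismatch densities of Thue--Morse arrays\<close>

definition square_sum :: "(int \<Rightarrow> int \<Rightarrow> real) \<Rightarrow> int \<Rightarrow> int \<Rightarrow> nat \<Rightarrow> real" where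
  "square_sum f p q n = (\<Sum>x\<in>{p..<p+int n}. \<Sum>y\<in>{q..<q+int n}. f x y)"

lemma sum_pairs_int:
  fixes f :: "int \<Rightarrow> real"
  shows "(\<Sum>m\<in>{p..<p+int k}. f (2*m+r) + f (2*m+r+1)) = (\<Sum>x\<in>{2*p+r..<2*p+r+2*int k}. f x)"
proof (induction k)
  case (Suc k)
  have "{2*p+r..<2*p+r+2*int (Suc k)} =
      insert (2*p+r+2*int k) (insert (2*p+r+2*int k+1) {2*p+r..<2*p+r+2*int k})"
    by auto
  moreover have "{p..<p+int (Suc k)} = insert (p+int k) {p..<p+int k}"
    by auto
  ultimately show ?case
    using Suc by (simp add: algebra_simps)
qed simp

text \<open>The pairs fill a window of length \<open>2 * (n div 2)\<close> starting at
  \<open>p\<close> or \<open>p+1\<close>, so at most one term is lost or gained at each end.\<close>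

lemma sum_halved_int:
  fixes f :: "int \<Rightarrow> real"
  assumes "\<And>x. \<bar>f x\<bar> \<le> B"
  shows "\<bar>(\<Sum>x\<in>{p..<p+int n}. f x) -
      (\<Sum>m\<in>{(p-r+1) div 2..<(p-r+1) div 2+int (n div 2)}. f (2*m+r) + f (2*m+r+1))\<bar> \<le> 2*B"
proof -
  define s where "s = 2*((p-r+1) div 2) + r"
  define k where "k = 2*int (n div 2)"
  have s: "s = p \<or> s = p + 1" and k: "k = int n \<or> k + 1 = int n"
    unfolding s_def k_def by presburger+
  have B: "0 \<le> B" using assms[of 0] by linarith
  have last: "(\<Sum>x\<in>{a..<a+int (Suc j)}. f x) = (\<Sum>x\<in>{a..<a+int j}. f x) + f (a + int j)" for a j
  proof -
    have "{a..<a+int (Suc j)} = insert (a+int j) {a..<a+int j}" by auto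
    then show ?thesis by simp
  qed
  have first: "(\<Sum>x\<in>{a..<a+int (Suc j)}. f x) = f a + (\<Sum>x\<in>{a+1..<a+1+int j}. f x)" for a j
  proof -
    have "{a..<a+int (Suc j)} = insert a {a+1..<a+1+int j}" by auto
    then show ?thesis by simp
  qed
  obtain j where j: "k = int j" using k_def by (metis of_nat_mult of_nat_numeral)
  have 1: "\<bar>(\<Sum>x\<in>{p..<p+int n}. f x) - (\<Sum>x\<in>{p..<p+int j}. f x)\<bar> \<le> B"
  proof (cases "k = int n")
    case True
    then show ?thesis using B by (simp add: j)
  next
    case False
    then have "n = Suc j" using k j by simp
    then show ?thesis using last[of p j] assms[of "p + int j"] by simp
  qed
  have 2: "\<bar>(\<Sum>x\<in>{p..<p+int n}. f x) - (\<Sum>x\<in>{s..<s+int j}. f x)\<bar> \<le> 2*B"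
  proof (cases "s = p")
    case True
    then show ?thesis using 1 B by simp
  next
    case False
    then have s: "s = p + 1" using s by simp
    show ?thesis
    proof (cases "k = int n")
      case True
      then show ?thesis
        using first[of p j] last[of p j] assms[of p] assms[of "p + int j"] by (simp add: s j)
    next
      case False
      then have "n = Suc j" using k j by simp
      then show ?thesis using first[of p j] assms[of p] B by (simp add: s)
    qed
  qed
  have "(\<Sum>m\<in>{(p-r+1) div 2..<(p-r+1) div 2+int (n div 2)}. f (2*m+r) + f (2*m+r+1)) =
      (\<Sum>x\<in>{s..<s+int j}. f x)"
    unfolding sum_pairs_int j[symmetric] by (simp add: s_def k_def)
  with 2 show ?thesis by simp
qed

lemma abs_sum_int_le:
  fixes f :: "int \<Rightarrow> real"
  assumes "\<And>x. \<bar>f x\<bar> \<le> B"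
  shows "\<bar>\<Sum>x\<in>{p..<p+int n}. f x\<bar> \<le> real n * B"
  using sum_norm_bound[of "{p..<p+int n}" f B] assms by simp

text \<open>Halving the first coordinate costs two columns, and halving the second costs two entries
  in each of at most \<open>n\<close> columns.\<close>

lemma square_sum_halved:
  assumes "\<And>x y. \<bar>f x y\<bar> \<le> 1"
  obtains p' q' where "\<bar>square_sum f p q n -
      (\<Sum>i\<in>{0,1}. \<Sum>j\<in>{0,1}. square_sum (\<lambda>x y. f (2*x+r+i) (2*y+s+j)) p' q' (n div 2))\<bar> \<le> 4 * real n"
proof -
  define p' where "p' = (p-r+1) div 2"
  define q' where "q' = (q-s+1) div 2"
  let ?k = "n div 2"
  define F where "F x = (\<Sum>y\<in>{q..<q+int n}. f x y)" for x
  define G where "G x = (\<Sum>y\<in>{q'..<q'+int ?k}. f x (2*y+s) + f x (2*y+s+1))" for x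
  have F: "\<bar>F x\<bar> \<le> real n" for x
    using abs_sum_int_le[of "f x" 1 q n] assms by (simp add: F_def)
  have "\<bar>(\<Sum>x\<in>{p..<p+int n}. F x) -
      (\<Sum>x\<in>{p'..<p'+int ?k}. F (2*x+r) + F (2*x+r+1))\<bar> \<le> 2 * real n"
    using sum_halved_int[of F "real n"] F unfolding p'_def by blast
  moreover have FG: "\<bar>F x - G x\<bar> \<le> 2" for x
    using sum_halved_int[of "f x" 1] assms unfolding F_def G_def q'_def by simp
  have "\<bar>\<Sum>x\<in>{p'..<p'+int ?k}. (F (2*x+r) + F (2*x+r+1)) - (G (2*x+r) + G (2*x+r+1))\<bar>
      \<le> real ?k * 4"
  proof (rule abs_sum_int_le)
    fix x show "\<bar>(F (2*x+r) + F (2*x+r+1)) - (G (2*x+r) + G (2*x+r+1))\<bar> \<le> 4"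
      using FG[of "2*x+r"] FG[of "2*x+r+1"] by linarith
  qed
  moreover have "real ?k * 4 \<le> 2 * real n"
    by linarith
  moreover have "(\<Sum>x\<in>{p'..<p'+int ?k}. G (2*x+r) + G (2*x+r+1)) =
      (\<Sum>i\<in>{0,1}. \<Sum>j\<in>{0,1}. square_sum (\<lambda>x y. f (2*x+r+i) (2*y+s+j)) p' q' ?k)"
    by (simp add: square_sum_def G_def sum.distrib algebra_simps)
  ultimately have "\<bar>square_sum f p q n -
      (\<Sum>i\<in>{0,1}. \<Sum>j\<in>{0,1}. square_sum (\<lambda>x y. f (2*x+r+i) (2*y+s+j)) p' q' ?k)\<bar> \<le> 4 * real n"
    unfolding sum_subtractf square_sum_def[of f] F_def[symmetric] by linarith
  then show ?thesis using that by blast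
qed

lemma square_sum_compl: "square_sum (\<lambda>x y. 1 - f x y) p q n = (real n)\<^sup>2 - square_sum f p q n"
  by (simp add: square_sum_def sum_subtractf power2_eq_square)

lemma square_sum_bounds:
  assumes "\<And>x y. 0 \<le> f x y" "\<And>x y. f x y \<le> 1"
  shows "0 \<le> square_sum f p q n" "square_sum f p q n \<le> (real n)\<^sup>2"
proof -
  show "0 \<le> square_sum f p q n"
    unfolding square_sum_def by (intro sum_nonneg assms)
  have "0 \<le> square_sum (\<lambda>x y. 1 - f x y) p q n"
    unfolding square_sum_def by (intro sum_nonneg) (simp add: assms)
  then show "square_sum f p q n \<le> (real n)\<^sup>2"
    unfolding square_sum_compl by simp
qed

section \<open>Density bounds for shifted arrays\<close>

definition mismatch :: "(int \<Rightarrow> int \<Rightarrow> bool) \<Rightarrow> int \<Rightarrow> int \<Rightarrow> int \<Rightarrow> int \<Rightarrow> real" where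
  "mismatch c s t x y = of_bool (c x y \<noteq> c (x + s) (y + t))"

text \<open>\<open>C\<close> absorbs boundary effects and is uniform in \<open>c\<close>, since
  desubstitution replaces the array by another one.\<close>

definition mismatch_density :: "int \<Rightarrow> int \<Rightarrow> real \<Rightarrow> real \<Rightarrow> bool" where
  "mismatch_density s t l u \<longleftrightarrow> 0 \<le> l \<and> u \<le> 1 \<and> (\<exists>C. \<forall>c p q n. leaf_bits c \<longrightarrow>
     l * (real n)\<^sup>2 - C * real n \<le> square_sum (mismatch c s t) p q n \<and>
     square_sum (mismatch c s t) p q n \<le> u * (real n)\<^sup>2 + C * real n)"

lemma mismatch_density_trivial: "mismatch_density s t 0 1"
  unfolding mismatch_density_def
  by (intro conjI exI[of _ 0]) (auto intro!: square_sum_bounds simp: mismatch_def)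

lemma mismatch_density_zero: "mismatch_density 0 0 0 0"
  unfolding mismatch_density_def
  by (intro conjI exI[of _ 0]) (auto simp: mismatch_def square_sum_def)

lemma mismatch_density_weaken:
  assumes "mismatch_density s t l u" "0 \<le> l'" "l' \<le> l" "u \<le> u'" "u' \<le> 1"
  shows "mismatch_density s t l' u'"
proof -
  obtain C where C: "\<And>c p q n. leaf_bits c \<Longrightarrow>
     l * (real n)\<^sup>2 - C * real n \<le> square_sum (mismatch c s t) p q n \<and>
     square_sum (mismatch c s t) p q n \<le> u * (real n)\<^sup>2 + C * real n"
    using assms(1) unfolding mismatch_density_def by blast
  have "l' * (real n)\<^sup>2 \<le> l * (real n)\<^sup>2" "u * (real n)\<^sup>2 \<le> u' * (real n)\<^sup>2" for n
    using assms by (simp_all add: mult_right_mono)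
  then show ?thesis
    unfolding mismatch_density_def using assms(2,5) C by (smt (verit))
qed

text \<open>The shift sends offset \<open>i\<close> to offset \<open>(s+i) mod 2\<close>, in the
  block \<open>(s+i) div 2\<close> further on. The sum of the two offsets changes parity iff
  \<open>s+t\<close> is odd.\<close>

lemma mismatch_desubstitute:
  assumes "\<And>m n i j. i \<in> {0, 1} \<Longrightarrow> j \<in> {0, 1} \<Longrightarrow>
      c (2*m+r+i) (2*n+r'+j) = (c' m n \<noteq> odd (i + j))"
    and "i \<in> {0, 1}" "j \<in> {0, 1}"
  shows "mismatch c s t (2*m+r+i) (2*n+r'+j) =
    (if even (s + t) then mismatch c' ((s+i) div 2) ((t+j) div 2) m n
     else 1 - mismatch c' ((s+i) div 2) ((t+j) div 2) m n)"
proof -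
  have eq: "2*m+r+i+s = 2*(m+(s+i) div 2)+r+(s+i) mod 2" "2*n+r'+j+t = 2*(n+(t+j) div 2)+r'+(t+j) mod 2"
    by presburger+
  have "(s+i) mod 2 \<in> {0, 1}" "(t+j) mod 2 \<in> {0, 1}"
    by auto
  from assms(1)[OF this] have "c (2*m+r+i+s) (2*n+r'+j+t) =
      (c' (m+(s+i) div 2) (n+(t+j) div 2) \<noteq> odd ((s+i) mod 2 + (t+j) mod 2))"
    unfolding eq .
  moreover have "odd ((s+i) mod 2 + (t+j) mod 2) \<longleftrightarrow> odd (i + j) \<noteq> odd (s + t)"
    by presburger
  ultimately show ?thesis
    using assms(1)[OF assms(2,3), of m n] unfolding mismatch_def by auto
qed

lemma mismatch_density_step:
  assumes "\<And>i j. i \<in> {0, 1} \<Longrightarrow> j \<in> {0, 1} \<Longrightarrow>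
      mismatch_density ((s+i) div 2) ((t+j) div 2) (l i j) (u i j)"
    and L: "4 * L = (\<Sum>i\<in>{0,1}. \<Sum>j\<in>{0,1}. if even (s + t) then l i j else 1 - u i j)"
    and U: "4 * U = (\<Sum>i\<in>{0,1}. \<Sum>j\<in>{0,1}. if even (s + t) then u i j else 1 - l i j)"
  shows "mismatch_density s t L U"
proof -
  define l' where "l' i j = (if even (s + t) then l i j else 1 - u i j)" for i j
  define u' where "u' i j = (if even (s + t) then u i j else 1 - l i j)" for i j
  have "\<exists>C. \<forall>c p q n. leaf_bits c \<longrightarrow>
     l i j * (real n)\<^sup>2 - C * real n \<le> square_sum (mismatch c ((s+i) div 2) ((t+j) div 2)) p q n \<and>
     square_sum (mismatch c ((s+i) div 2) ((t+j) div 2)) p q n \<le> u i j * (real n)\<^sup>2 + C * real n"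
    if "i \<in> {0, 1}" "j \<in> {0, 1}" for i j :: int
    using assms(1)[OF that] unfolding mismatch_density_def by blast
  then obtain C where C: "\<And>i j c p q n. i \<in> {0, 1} \<Longrightarrow> j \<in> {0, 1} \<Longrightarrow> leaf_bits c \<Longrightarrow>
     l i j * (real n)\<^sup>2 - C i j * real n \<le> square_sum (mismatch c ((s+i) div 2) ((t+j) div 2)) p q n \<and>
     square_sum (mismatch c ((s+i) div 2) ((t+j) div 2)) p q n \<le> u i j * (real n)\<^sup>2 + C i j * real n"
    by metis
  \<comment> \<open>The errors of the four sublattices, \<open>4 * n\<close> from splitting the
    square, and the cost of replacing \<open>4 * k^2\<close> by \<open>n^2\<close>.\<close>
  define D where "D = (\<Sum>i\<in>{0,1}. \<Sum>j\<in>{0,1}. \<bar>C i j\<bar>) + 4 + 2 * \<bar>L\<bar> + 2 * \<bar>U\<bar>"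
  have lu: "0 \<le> l' i j" "u' i j \<le> 1" if "i \<in> {0, 1}" "j \<in> {0, 1}" for i j
    using assms(1)[OF that] by (auto simp: mismatch_density_def l'_def u'_def)
  have L': "4 * L = (\<Sum>i\<in>{0,1}. \<Sum>j\<in>{0,1}. l' i j)"
    and U': "4 * U = (\<Sum>i\<in>{0,1}. \<Sum>j\<in>{0,1}. u' i j)"
    unfolding L U l'_def u'_def by simp_all
  have "0 \<le> L" "U \<le> 1"
    using L' U' lu[of 0 0] lu[of 0 1] lu[of 1 0] lu[of 1 1] by simp_all
  moreover have "L * (real n)\<^sup>2 - D * real n \<le> square_sum (mismatch c s t) p q n \<and>
     square_sum (mismatch c s t) p q n \<le> U * (real n)\<^sup>2 + D * real n"
    if "leaf_bits c" for c p q n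
  proof -
    obtain c' r r' where c': "leaf_bits c'" and desub: "\<And>m n i j. i \<in> {0, 1} \<Longrightarrow> j \<in> {0, 1} \<Longrightarrow>
        c (2*m+r+i) (2*n+r'+j) = (c' m n \<noteq> odd (i + j))"
      using leaf_bits_desubstitute[OF \<open>leaf_bits c\<close>] by metis
    let ?f = "\<lambda>i j x y. mismatch c s t (2*x+r+i) (2*y+r'+j)"
    define k where "k = n div 2"
    obtain p' q' where half: "\<bar>square_sum (mismatch c s t) p q n -
        (\<Sum>i\<in>{0,1}. \<Sum>j\<in>{0,1}. square_sum (?f i j) p' q' k)\<bar> \<le> 4 * real n"
      using square_sum_halved[of "mismatch c s t" p q n r r'] unfolding k_def
      by (auto simp: mismatch_def)
    have child: "l' i j * (real k)\<^sup>2 - \<bar>C i j\<bar> * real n \<le> square_sum (?f i j) p' q' k \<and>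
        square_sum (?f i j) p' q' k \<le> u' i j * (real k)\<^sup>2 + \<bar>C i j\<bar> * real n"
      if ij: "i \<in> {0, 1}" "j \<in> {0, 1}" for i j
    proof -
      let ?g = "mismatch c' ((s+i) div 2) ((t+j) div 2)"
      have f: "?f i j = (if even (s + t) then ?g else (\<lambda>x y. 1 - ?g x y))"
        using mismatch_desubstitute[of c r r' c' i j s t, OF desub ij] by (intro ext) simp
      have "C i j * real k \<le> \<bar>C i j\<bar> * real n"
        unfolding k_def by (intro mult_mono) auto
      then show ?thesis
        using C[OF ij c', of k p' q'] unfolding f l'_def u'_def
        by (auto simp: square_sum_compl left_diff_distrib)
    qed
    have sq: "\<bar>4 * (A * (real k)\<^sup>2) - A * (real n)\<^sup>2\<bar> \<le> 2 * \<bar>A\<bar> * real n" for A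
    proof -
      have "n = 2 * k \<or> n = 2 * k + 1"
        unfolding k_def by presburger
      then have "\<bar>4 * (real k)\<^sup>2 - (real n)\<^sup>2\<bar> \<le> 2 * real n"
        by (auto simp: power2_eq_square algebra_simps)
      then have "\<bar>A\<bar> * \<bar>4 * (real k)\<^sup>2 - (real n)\<^sup>2\<bar> \<le> \<bar>A\<bar> * (2 * real n)"
        by (rule mult_left_mono) simp
      then show ?thesis
        unfolding abs_mult[symmetric] by (simp add: algebra_simps)
    qed
    have "4 * (L * (real k)\<^sup>2) = (\<Sum>i\<in>{0,1}. \<Sum>j\<in>{0,1}. l' i j * (real k)\<^sup>2)"
      "4 * (U * (real k)\<^sup>2) = (\<Sum>i\<in>{0,1}. \<Sum>j\<in>{0,1}. u' i j * (real k)\<^sup>2)"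
      using L' U' unfolding sum_distrib_right[symmetric] by (simp_all flip: mult.assoc)
    then show ?thesis
      using sq[of L] sq[of U] half child[of 0 0] child[of 0 1] child[of 1 0] child[of 1 1]
      unfolding D_def by (simp add: algebra_simps abs_le_iff)
  qed
  ultimately show ?thesis
    unfolding mismatch_density_def by blast
qed

text \<open>Two of the halved shifts are zero and two equal \<open>(s, t)\<close>, so a density
  \<open>d\<close> would obey \<open>d = 1 - d/2\<close>. Two rounds from the trivial bounds 0 and 1
  suffice.\<close>

lemma mismatch_density_axis:
  assumes "\<bar>s\<bar> + \<bar>t\<bar> = 1"
  shows "mismatch_density s t (1/2) (3/4)"
proof -
  have child: "(s+i) div 2 = 0 \<and> (t+j) div 2 = 0 \<or> (s+i) div 2 = s \<and> (t+j) div 2 = t"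
    if "i \<in> {0, 1}" "j \<in> {0, 1}" for i j
    using assms that by (auto; presburger)
  consider "s = 1" "t = 0" | "s = -1" "t = 0" | "s = 0" "t = 1" | "s = 0" "t = -1"
    using assms by linarith
  note st = this
  have step: "mismatch_density s t (1 - u / 2) (1 - l / 2)"
    if "mismatch_density s t l u" for l u
  proof -
    define z where "z i j \<longleftrightarrow> (s+i) div 2 = 0 \<and> (t+j) div 2 = 0" for i j
    show ?thesis
    proof (rule mismatch_density_step)
      show "mismatch_density ((s+i) div 2) ((t+j) div 2) (if z i j then 0 else l) (if z i j then 0 else u)"
        if "i \<in> {0, 1}" "j \<in> {0, 1}" for i j
        using child[OF that] \<open>mismatch_density s t l u\<close> mismatch_density_zero
        by (auto simp: z_def)
    qed (use st in \<open>cases; simp add: z_def\<close>)+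
  qed
  show ?thesis
    using step[OF mismatch_density_weaken[OF step[OF mismatch_density_trivial], of "1/2" 1]] by simp
qed

text \<open>One halved shift is zero, two are axis shifts, and the last is \<open>(s, t)\<close>
  itself, for which the trivial bounds do: the mean of 0, 1/2, 1/2, 0 is 1/4, that of 0, 3/4, 3/4, 1
  is 5/8.\<close>

lemma mismatch_density_diagonal:
  assumes "\<bar>s\<bar> = 1" "\<bar>t\<bar> = 1"
  shows "mismatch_density s t (1/4) (3/4)"
proof -
  define w where "w i j = \<bar>(s+i) div 2\<bar> + \<bar>(t+j) div 2\<bar>" for i j
  consider "s = 1" "t = 1" | "s = 1" "t = -1" | "s = -1" "t = 1" | "s = -1" "t = -1"
    using assms by linarith
  note st = this
  have "mismatch_density s t (1/4) (5/8)"
  proof (rule mismatch_density_step)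
    show "mismatch_density ((s+i) div 2) ((t+j) div 2)
        (if w i j = 1 then 1/2 else 0) (if w i j = 0 then 0 else if w i j = 1 then 3/4 else 1)"
      for i j
      using mismatch_density_axis[of "(s+i) div 2" "(t+j) div 2"] mismatch_density_zero
        mismatch_density_trivial by (auto simp: w_def)
  qed (use st in \<open>cases; simp add: w_def\<close>)+
  then show ?thesis
    by (rule mismatch_density_weaken) simp_all
qed

text \<open>A coordinate of absolute value at least 2 shrinks but stays nonzero when halved, so
  induction covers all four halved shifts. Complements preserve the symmetric interval from 1/4 to
  3/4.\<close>

lemma mismatch_density:
  assumes "(s, t) \<noteq> (0, 0)"
  shows "mismatch_density s t (1/4) (3/4)"
  using assms
proof (induction "nat (\<bar>s\<bar> + \<bar>t\<bar>)" arbitrary: s t rule: less_induct)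
  case less
  consider "\<bar>s\<bar> + \<bar>t\<bar> = 1" | "\<bar>s\<bar> = 1" "\<bar>t\<bar> = 1" | "2 \<le> \<bar>s\<bar> \<or> 2 \<le> \<bar>t\<bar>"
    using less.prems by fastforce
  then show ?case
  proof cases
    case 1
    then show ?thesis
      using mismatch_density_weaken[OF mismatch_density_axis] by simp
  next
    case 2
    then show ?thesis by (rule mismatch_density_diagonal)
  next
    case 3
    show ?thesis
    proof (rule mismatch_density_step[where l = "\<lambda>_ _. 1/4" and u = "\<lambda>_ _. 3/4"])
      fix i j :: int
      assume ij: "i \<in> {0, 1}" "j \<in> {0, 1}"
      have small: "\<bar>(z+i) div 2\<bar> \<le> \<bar>z\<bar>"
        and large: "2 \<le> \<bar>z\<bar> \<Longrightarrow> \<bar>(z+i) div 2\<bar> < \<bar>z\<bar> \<and> (z+i) div 2 \<noteq> 0"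
        if "i \<in> {0, 1}" for z i :: int
        using that by (auto; presburger)+
      show "mismatch_density ((s+i) div 2) ((t+j) div 2) (1/4) (3/4)"
        using 3 small[OF ij(1), of s] small[OF ij(2), of t] large[OF ij(1), of s] large[OF ij(2), of t]
        by (intro less.hyps) auto
    qed simp_all
  qed
qed


subsection \<open>Existence of a configuration\<close>

fun thue :: "nat \<Rightarrow> bool" where
  "thue n = (if n = 0 then False else odd n \<noteq> thue (n div 2))"

declare thue.simps [simp del]

lemma thue_double: "thue (2*n) = thue n" "thue (2*n+1) = (\<not> thue n)"
proof -
  show "thue (2*n) = thue n"
    by (cases "n = 0") (simp, subst thue.simps, simp)
  show "thue (2*n+1) = (\<not> thue n)"
    by (subst thue.simps) simp
qed

text \<open>No extension of the Thue--Morse sequence to negative indices satisfies both recursion equations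
  at \<open>-1\<close>, as \<open>2 \<cdot> (-1) + 1 = -1\<close>; hence the dependence on the level \<open>k\<close>.\<close>

definition thue_int :: "nat \<Rightarrow> int \<Rightarrow> bool" where
  "thue_int k m = (if 0 \<le> m then thue (nat m) else thue (nat (-1-m)) \<noteq> odd k)"

text \<open>For negative \<open>m\<close> the reflection \<open>-1-m\<close> swaps even and odd
  indices; the change of parity from \<open>k\<close> to \<open>Suc k\<close> makes up for the
  misplaced negation.\<close>

lemma thue_int_double:
  "thue_int k (2*m) = thue_int (Suc k) m" "thue_int k (2*m+1) = (\<not> thue_int (Suc k) m)"
proof -
  have "thue_int k (2*m) = thue_int (Suc k) m \<and> thue_int k (2*m+1) = (\<not> thue_int (Suc k) m)"
  proof (cases "0 \<le> m")
    case True
    then have "nat (2*m) = 2 * nat m" "nat (2*m+1) = 2 * nat m + 1" by simp_all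
    then show ?thesis using True thue_double[of "nat m"] by (simp add: thue_int_def)
  next
    case False
    then have "nat (-1-2*m) = 2 * nat (-1-m) + 1" "nat (-1-(2*m+1)) = 2 * nat (-1-m)"
      by linarith+
    then show ?thesis using False thue_double[of "nat (-1-m)"] by (auto simp: thue_int_def)
  qed
  then show "thue_int k (2*m) = thue_int (Suc k) m" "thue_int k (2*m+1) = (\<not> thue_int (Suc k) m)"
    by auto
qed

lemma thue_int_halve: "thue_int k i = (thue_int (Suc k) (i div 2) \<noteq> odd i)"
  using thue_int_double[of k "i div 2"] by (cases "even i") auto

lemma pow2_times_odd:
  fixes x :: int
  assumes "x \<noteq> 0"
  shows "\<exists>k m. x = 2^k * (2*m+1)"
  using assms
proof (induction "nat \<bar>x\<bar>" arbitrary: x rule: less_induct)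
  case less
  show ?case
  proof (cases "even x")
    case True
    then obtain z where z: "x = 2*z" by blast
    with less.prems have "z \<noteq> 0" "nat \<bar>z\<bar> < nat \<bar>x\<bar>" by auto
    then obtain k m where "z = 2^k * (2*m+1)"
      using less.hyps[of z] by blast
    then have "x = 2^Suc k * (2*m+1)" using z by simp
    then show ?thesis by blast
  next
    case False
    then have "x = 2^0 * (2*(x div 2)+1)" by simp
    then show ?thesis by blast
  qed
qed

text \<open>The mark above row \<open>y\<close> in column \<open>2^k (2m+1)\<close>: the arrow comes from the cross in row
  \<open>2^k (2n+1)\<close>, where \<open>n = y div 2^(k+1)\<close>.\<close>

definition arm :: "nat \<Rightarrow> int \<Rightarrow> int \<Rightarrow> mark" where
  "arm k m y = Mark (odd (y div 2^k)) (k = 0 \<or> (y div 2^(k-1)) mod 4 \<in> {0, 3}) (odd m)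
     (odd (y div 2^k div 2)) (thue_int k m \<noteq> thue_int k (y div 2^k div 2))"

lemma pow2_mult_minus_1_div: "(2^k * z - 1) div 2^k = z - 1" for z :: int
proof -
  have "2^k * z - 1 = (2^k - 1) + 2^k * (z - 1)" by (simp add: algebra_simps)
  moreover have "((2^k - 1) + 2^k * (z - 1)) div 2^k = (z - 1) + (2^k - 1) div 2^k"
    by (rule div_mult_self2) simp
  moreover have "(2^k - 1) div 2^k = (0::int)"
    by (rule div_pos_pos_trivial) simp_all
  ultimately show ?thesis by (simp only: add_0_right)
qed

lemma arm_at_cross:
  "arm k m (2^k * (2*n+1)) = Mark True (k = 0) (odd m) (odd n) (thue_int k m \<noteq> thue_int k n)"
  "arm k m (2^k * (2*n+1) - 1) = Mark False (k = 0) (odd m) (odd n) (thue_int k m \<noteq> thue_int k n)"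
proof -
  have 1: "2^Suc j * (2*n+1) div 2^j = 2*(2*n+1)" "(2^Suc j * (2*n+1) - 1) div 2^j = 2*(2*n+1) - 1" for j
  proof -
    have "2^Suc j * (2*n+1) = 2^j * (2*(2*n+1))" by simp
    then show "2^Suc j * (2*n+1) div 2^j = 2*(2*n+1)"
      "(2^Suc j * (2*n+1) - 1) div 2^j = 2*(2*n+1) - 1"
      by (simp_all only: pow2_mult_minus_1_div) simp
  qed
  have 2: "(2*(2*n+1)) mod 4 = 2" "(2*(2*n+1) - 1) mod 4 = 1"
    by presburger+
  show "arm k m (2^k * (2*n+1)) = Mark True (k = 0) (odd m) (odd n) (thue_int k m \<noteq> thue_int k n)"
    "arm k m (2^k * (2*n+1) - 1) = Mark False (k = 0) (odd m) (odd n) (thue_int k m \<noteq> thue_int k n)"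
    unfolding arm_def pow2_mult_minus_1_div
    by (cases k; simp add: 1[unfolded power_Suc] 2 del: power_Suc; simp add: 1 2)+
qed

text \<open>These are row 0 and the rows of level above \<open>k\<close>; the arrows of the crosses
  \<open>n\<close> above and \<open>n-1\<close> below end there.\<close>

lemma arm_at_end:
  "arm k m (2^k * (2*n)) = Mark False True (odd m) (odd n) (thue_int k m \<noteq> thue_int k n)"
  "arm k m (2^k * (2*n) - 1) = Mark True True (odd m) (even n) (thue_int k m \<noteq> thue_int k (n - 1))"
proof -
  have 1: "2^Suc j * (2*n) div 2^j = 4*n" "(2^Suc j * (2*n) - 1) div 2^j = 4*n - 1" for j
    using pow2_mult_minus_1_div[of j "4*n"] by (simp_all add: mult.assoc mult.left_commute)
  have 2: "(4*n) mod 4 = 0" "(4*n - 1) mod 4 = 3" "(2*n-1) div 2 = n - 1"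
    by presburger+
  show "arm k m (2^k * (2*n)) = Mark False True (odd m) (odd n) (thue_int k m \<noteq> thue_int k n)"
    "arm k m (2^k * (2*n) - 1) = Mark True True (odd m) (even n) (thue_int k m \<noteq> thue_int k (n - 1))"
    unfolding arm_def pow2_mult_minus_1_div
    by (cases k; simp add: 1 2 del: power_Suc)+
qed

text \<open>From \<open>y-1\<close> to \<open>y\<close> the value of \<open>div 2^l\<close> changes
  only for \<open>l \<le> j\<close>. Only the phase depends on \<open>l = k-1\<close>, all else on
  \<open>l \<ge> k\<close>; so the mark changes only at rows of level \<open>k-1\<close>, halfway
  along the arrow.\<close>

lemma arm_pass:
  assumes "j < k" "y = 2^j * (2*i+1)"
  shows "pass (k = Suc j) (arm k m (y-1)) (arm k m y)"
proof -
  have div_j: "y div 2^j = 2*i+1" "(y-1) div 2^j = 2*i"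
    using pow2_mult_minus_1_div[of j "2*i+1"] by (simp_all add: assms(2))
  have div_Suc: "z div 2^Suc l = z div 2^l div 2" for z :: int and l
    unfolding power_Suc2 by (rule zdiv_zmult2_eq) simp
  have eq: "(y-1) div 2^l = y div 2^l" if "j < l" for l
    using that
  proof (induction l)
    case (Suc l)
    then show ?case
      unfolding div_Suc using div_j by (cases "j = l") auto
  qed simp
  show ?thesis
  proof (cases "k = Suc j")
    case True
    have "(2*i) mod 4 \<in> {0, 3} \<longleftrightarrow> even i" "(2*i+1) mod 4 \<in> {0, 3} \<longleftrightarrow> odd i"
      by (auto; presburger)+
    moreover have "(2*i+1) div 2 = i" "(2*i) div 2 = i" by simp_all
    ultimately show ?thesis
      unfolding True arm_def pass_def mark.sel div_Suc diff_Suc_1 div_j by simp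
  next
    case False
    then have "j < k - 1" using assms(1) by simp
    then show ?thesis
      using eq[OF assms(1)] eq[of "k-1"] False by (simp add: arm_def pass_False_iff)
  qed
qed

lemma conf_exists: "\<exists>N E. conf odd odd N E"
proof -
  obtain lev :: "int \<Rightarrow> nat" and idx :: "int \<Rightarrow> int"
    where dec: "\<And>x. x \<noteq> 0 \<Longrightarrow> x = 2^lev x * (2*idx x+1)"
    using pow2_times_odd by metis
  \<comment> \<open>Column 0 and row 0 are of infinite level.\<close>
  define N where "N x y = (if x = 0 then Mark (0 \<le> y) False False False False
      else arm (lev x) (idx x) y)" for x y
  define E where "E x y = flip (N y x)" for x y
  have odd_iff: "odd x \<longleftrightarrow> lev x = 0" if "x \<noteq> 0" for x
    by (subst dec[OF that]) auto
  have column: "cell (odd x) (odd y) (N x y) (E x y) (N x (y-1)) (E (x-1) y)"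
    if y: "y \<noteq> 0" and less: "x = 0 \<or> lev y < lev x" for x y
  proof -
    define k i where "k = lev y" and "i = idx y"
    have y_eq: "y = 2^k * (2*i+1)" using dec[OF y] by (simp add: k_def i_def)
    \<comment> \<open>\<open>n\<close> is the column in units of \<open>2^(k+1)\<close>: it is odd
      iff the level is \<open>k+1\<close>, and then the column bisects squares of level
      \<open>k\<close> crosses. Column 0 gets the even value 0.\<close>
    obtain n where n: "x = 2^k * (2*n)" "x = 0 \<longrightarrow> even n" "x \<noteq> 0 \<longrightarrow> odd n = (lev x = Suc k)"
      "x \<noteq> 0 \<longrightarrow> lev x = Suc k \<longrightarrow> n = 2 * idx x + 1"
    proof (cases "x = 0")
      case True
      then show ?thesis using that[of 0] by simp
    next
      case False
      with less have "lev x = Suc k + (lev x - Suc k)" by (simp add: k_def)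
      then obtain d where d: "lev x = Suc k + d" by blast
      show ?thesis
        using dec[OF False] False d
        by (intro that[of "2^d * (2*idx x+1)"]) (auto simp: power_add)
    qed
    have w: "E (x-1) y = Mark True True (even n) (odd i) (thue_int k i \<noteq> thue_int k (n-1))"
      and e: "E x y = Mark False True (odd n) (odd i) (thue_int k i \<noteq> thue_int k n)"
      using y arm_at_end[of k i n] by (simp_all add: E_def N_def n(1) k_def i_def)
    have p: "pass (odd n) (N x (y-1)) (N x y)"
    proof (cases "x = 0")
      case True
      then show ?thesis using n(2) y by (auto simp: N_def pass_False_iff)
    next
      case False
      then show ?thesis
        using less n(3) arm_pass[OF _ y_eq, of "lev x" "idx x"] by (simp add: N_def k_def)
    qed
    have b: "bit (E (x-1) y) = (bit (N x (y-1)) \<noteq> odd i) \<and> bit (E x y) = (bit (N x (y-1)) = odd i)"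
      if "odd n"
    proof -
      have x: "x \<noteq> 0" "lev x = Suc k" "n = 2 * idx x + 1"
        using that n(2-4) by blast+
      \<comment> \<open>The vertical arrow comes from the level \<open>k+1\<close> cross of row
        index \<open>i div 2\<close>; the recursion of \<open>thue_int\<close> turns its bit into
        those of the corners.\<close>
      have "y div 2^k div 2 = i"
        unfolding y_eq by simp
      moreover have "y div 2^Suc k = y div 2^k div 2"
        unfolding power_Suc2 by (rule zdiv_zmult2_eq) simp
      ultimately have "y div 2^Suc k = i"
        by (rule trans[rotated])
      then have "bit (N x y) = (thue_int (Suc k) (idx x) \<noteq> thue_int (Suc k) (i div 2))"
        using x by (simp add: N_def arm_def del: power_Suc)
      moreover have "bit (N x (y-1)) = bit (N x y)"
        using p by (simp add: pass_def)
      ultimately show ?thesis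
        using thue_int_halve[of k i] thue_int_double[of k "idx x"] by (auto simp: w e x(3))
    qed
    have "even x" by (simp add: n(1))
    moreover have "column_cell (E (x-1) y) (E x y) (N x (y-1)) (N x y)"
      unfolding column_cell_def using p b by (auto simp: w e)
    ultimately show ?thesis by (simp add: cell_def)
  qed
  have "cell (odd x) (odd y) (N x y) (E x y) (N x (y-1)) (E (x-1) y)" for x y
  proof -
    consider "x = 0" "y = 0" | "y \<noteq> 0" "x = 0 \<or> lev y < lev x" | "x \<noteq> 0" "y = 0 \<or> lev x < lev y"
      | "x \<noteq> 0" "y \<noteq> 0" "lev x = lev y"
      by linarith
    then show ?thesis
    proof cases
      case 1
      then show ?thesis by (auto simp: cell_def cross_def N_def E_def)
    next
      case 2
      then show ?thesis by (rule column)
    next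
      case 3
      then show ?thesis
        using column[of x y] cell_flip[of "odd y" "odd x" "E x y" "N x y" "E (x-1) y" "N x (y-1)"]
        by (simp add: E_def)
    next
      case 4
      define k where "k = lev x"
      have x: "x = 2^k * (2*idx x+1)" and y: "y = 2^k * (2*idx y+1)"
        using dec[OF 4(1)] dec[OF 4(2)] unfolding k_def 4(3) by blast+
      have "cross (k = 0) (N x y) (E x y) (N x (y-1)) (E (x-1) y)"
        using arm_at_cross[of k "idx x" "idx y", folded y] arm_at_cross[of k "idx y" "idx x", folded x] 4
        by (auto simp: cross_def N_def E_def simp flip: k_def 4(3))
      then show ?thesis using odd_iff 4 by (simp add: cell_def k_def)
    qed
  qed
  then show ?thesis unfolding conf_def by blast
qed


subsection \<open>The tile set\<close>

type_synonym colour = "bool \<times> bool \<times> bool \<times> mark"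

text \<open>Besides the mark, a colour shows the levels being 0 and the block bit \<open>g\<close> of the cell to the south
  or west of the edge. The blocks \<open>2 \<times> 2\<close> have the crosses of level 0 at the lower left.\<close>

definition tiles :: "colour tile set" where
  "tiles = {((A, B, g, n), (A, B, g, e), (A, \<not> B, g', s), (\<not> A, B, g'', w)) | A B g g' g'' n e s w.
     cell A B n e s w \<and> (A \<and> B \<longrightarrow> g = bit n) \<and> (\<not> B \<longrightarrow> g' = g) \<and> (\<not> A \<longrightarrow> g'' = g)}"

section \<open>Renaming of colours\<close>

definition map_tile :: "('a \<Rightarrow> 'b) \<Rightarrow> 'a tile \<Rightarrow> 'b tile" where
  "map_tile f t = (f (north t), f (east t), f (south t), f (west t))"

lemma map_tile_sel [simp]:
  "north (map_tile f t) = f (north t)" "east (map_tile f t) = f (east t)"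
  "south (map_tile f t) = f (south t)" "west (map_tile f t) = f (west t)"
  by (simp_all add: map_tile_def north_def east_def south_def west_def)

lemma tiling_map_tile: "tiling S V \<Longrightarrow> tiling (map_tile f ` S) (map_tile f \<circ> V)"
  by (simp add: tiling_def)

lemma map_tile_inv:
  assumes "inj f"
  shows "map_tile (inv f) (map_tile f t) = t"
  by (cases t) (simp add: map_tile_def north_def east_def south_def west_def inv_f_f[OF assms])

lemma tiling_map_tile_inv:
  assumes "inj f" "tiling (map_tile f ` S) U"
  shows "tiling S (map_tile (inv f) \<circ> U)"
proof -
  have "map_tile (inv f) ` map_tile f ` S = S"
    by (simp add: image_image map_tile_inv[OF assms(1)])
  then show ?thesis
    using tiling_map_tile[OF assms(2), of "inv f"] by simp
qed

lemma finite_tiles: "finite tiles"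
  by (rule finite_subset[OF subset_UNIV finite])

lemma tiling_tiles_exists: "\<exists>V. tiling tiles V"
proof -
  obtain N E where conf: "conf odd odd N E"
    using conf_exists by blast
  \<comment> \<open>\<open>2 * ((x+1) div 2) - 1\<close> is the greatest odd number not above
    \<open>x\<close>.\<close>
  define g where "g x y = bit (N (2 * ((x+1) div 2) - 1) (2 * ((y+1) div 2) - 1))" for x y :: int
  define V where "V = (\<lambda>(x, y). ((odd x, odd y, g x y, N x y), (odd x, odd y, g x y, E x y),
    (odd x, even y, g x (y-1), N x (y-1)), (even x, odd y, g (x-1) y, E (x-1) y)))"
  have "V (x, y) \<in> tiles" for x y
  proof -
    have "g x y = bit (N x y)" if "odd x" "odd y"
    proof -
      have "2 * ((x+1) div 2) - 1 = x" "2 * ((y+1) div 2) - 1 = y"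
        using that by presburger+
      then show ?thesis by (simp add: g_def)
    qed
    moreover have "g x (y-1) = g x y" if "even y"
    proof -
      have "(y-1+1) div 2 = (y+1) div 2" using that by presburger
      then show ?thesis by (simp add: g_def)
    qed
    moreover have "g (x-1) y = g x y" if "even x"
    proof -
      have "(x-1+1) div 2 = (x+1) div 2" using that by presburger
      then show ?thesis by (simp add: g_def)
    qed
    moreover have "cell (odd x) (odd y) (N x y) (E x y) (N x (y-1)) (E (x-1) y)"
      using conf by (simp add: conf_def)
    ultimately show ?thesis
      unfolding V_def tiles_def by auto
  qed
  then have "tiling tiles V"
    by (simp add: tiling_def V_def north_def east_def south_def west_def)
  then show ?thesis by blast
qed

section \<open>From tilings back to configurations\<close>

definition block_bit :: "colour tile \<Rightarrow> bool" where
  "block_bit t = fst (snd (snd (north t)))"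

lemma tiling_tilesE:
  assumes "tiling tiles V"
  obtains c r s where "leaf_bits c"
    "\<And>x y t u. odd t \<or> odd u \<Longrightarrow> V (x, y) \<noteq> V (x + t, y + u)"
    "\<And>m n i j. i \<in> {0, 1} \<Longrightarrow> j \<in> {0, 1} \<Longrightarrow> block_bit (V (2*m+r+i, 2*n+s+j)) = c m n"
proof -
  define A where "A x y = fst (north (V (x, y)))" for x y
  define B where "B x y = fst (snd (north (V (x, y))))" for x y
  define g where "g x y = block_bit (V (x, y))" for x y
  define N where "N x y = snd (snd (snd (north (V (x, y)))))" for x y
  define E where "E x y = snd (snd (snd (east (V (x, y)))))" for x y
  have V: "V (x, y) \<in> tiles" and east: "west (V (x, y)) = east (V (x - 1, y))"
    and north: "south (V (x, y)) = north (V (x, y - 1))" for x y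
    using assms[unfolded tiling_def, rule_format, of x y] assms[unfolded tiling_def, rule_format, of "x-1" y]
      assms[unfolded tiling_def, rule_format, of x "y-1"] by simp_all
  note sel = north_def east_def south_def west_def
  have local: "east (V (x, y)) = (A x y, B x y, g x y, E x y)"
    "fst (south (V (x, y))) = A x y" "fst (snd (south (V (x, y)))) = (\<not> B x y)"
    "fst (west (V (x, y))) = (\<not> A x y)" "fst (snd (west (V (x, y)))) = B x y"
    "A x y \<and> B x y \<longrightarrow> g x y = bit (N x y)"
    "\<not> B x y \<longrightarrow> fst (snd (snd (south (V (x, y))))) = g x y"
    "\<not> A x y \<longrightarrow> fst (snd (snd (west (V (x, y))))) = g x y"
    "cell (A x y) (B x y) (N x y) (E x y) (snd (snd (snd (south (V (x, y))))))
      (snd (snd (snd (west (V (x, y))))))" for x y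
    using V[of x y] unfolding A_def B_def g_def N_def E_def block_bit_def tiles_def
    by (auto simp: sel)
  have step: "A x y = A x (y-1)" "B x (y-1) = (\<not> B x y)" "A (x-1) y = (\<not> A x y)" "B (x-1) y = B x y"
    "\<not> B x y \<Longrightarrow> g x (y-1) = g x y" "\<not> A x y \<Longrightarrow> g (x-1) y = g x y"
    "cell (A x y) (B x y) (N x y) (E x y) (N x (y-1)) (E (x-1) y)" for x y
    using local(2-9)[of x y] unfolding east north local(1)
    by (simp_all add: A_def B_def g_def N_def block_bit_def)
  have succ: "A x (y+1) = A x y" "B x (y+1) = (\<not> B x y)" "A (x+1) y = (\<not> A x y)" "B (x+1) y = B x y"
    for x y
    using step(1,2)[of x "y+1"] step(3,4)[of "x+1" y] by auto
  have A: "A x y = (A 0 0 \<noteq> odd x)" for x y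
    using alternating_int[of "\<lambda>x. A x y" x, OF succ(3)] constant_int[of "A 0" y, OF succ(1)] by simp
  have B: "B x y = (B 0 0 \<noteq> odd y)" for x y
    using alternating_int[of "B x" y, OF succ(2)] constant_int[of "\<lambda>x. B x 0" x, OF succ(4)] by simp
  \<comment> \<open>The displayed parities may start either way; the shift moves level 0 to odd
    coordinates.\<close>
  define r :: int where "r = (if A 0 0 then 1 else 0)"
  define s :: int where "s = (if B 0 0 then 1 else 0)"
  have AB: "A (x + r) y = odd x" "B x (y + s) = odd y" for x y
    using A[of "x + r" y] B[of x "y + s"] by (auto simp: r_def s_def)
  define N' where "N' x y = N (x + r) (y + s)" for x y
  define E' where "E' x y = E (x + r) (y + s)" for x y
  define c where "c m n = bit (E' (2*m-1) (2*n-1))" for m n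
  have conf: "conf odd odd N' E'"
    unfolding conf_def
  proof (intro allI)
    fix x y
    have eq: "x - 1 + r = x + r - 1" "y - 1 + s = y + s - 1" by simp_all
    show "cell (odd x) (odd y) (N' x y) (E' x y) (N' x (y - 1)) (E' (x - 1) y)"
      using step(7)[of "x + r" "y + s"] unfolding AB N'_def E'_def eq .
  qed
  have "leaf_bits c"
    unfolding leaf_bits_def c_def[abs_def] using conf by blast
  moreover have "V (x, y) \<noteq> V (x + t, y + u)" if "odd t \<or> odd u" for x y t u
  proof
    assume "V (x, y) = V (x + t, y + u)"
    then have "A x y = A (x + t) (y + u)" "B x y = B (x + t) (y + u)"
      by (simp_all add: A_def B_def)
    then show False
      using that A[of x y] A[of "x+t" "y+u"] B[of x y] B[of "x+t" "y+u"] by auto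
  qed
  moreover have "block_bit (V (2*m+(r-1)+i, 2*n+(s-1)+j)) = c m n"
    if "i \<in> {0, 1}" "j \<in> {0, 1}" for m n i j
  proof -
    define x y where "x = 2*m-1+r" and "y = 2*n-1+s"
    have leaf: "A x v" "B v y" "\<not> A (x+1) v" "\<not> B v (y+1)" for v
      using AB(1)[of "2*m-1" v] AB(1)[of "2*m" v] AB(2)[of v "2*n-1"] AB(2)[of v "2*n"]
      by (simp_all add: x_def y_def)
    have "bit (N x y) = c m n"
      using odd_odd_cell[OF conf, of m n] by (auto simp: cross_def c_def N'_def E'_def x_def y_def)
    then have "g x y = c m n"
      using local(6)[of x y] leaf by simp
    moreover have "g (x+1) v = g x v" "g v (y+1) = g v y" for v
      using step(5)[of v "y+1"] step(6)[of "x+1" v] leaf by simp_all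
    ultimately have "g (x + i) (y + j) = c m n"
      using that by (elim insertE emptyE) simp_all
    moreover have "2*m+(r-1)+i = x + i" "2*n+(s-1)+j = y + j"
      by (simp_all add: x_def y_def)
    ultimately show ?thesis
      by (simp only: g_def)
  qed
  ultimately show ?thesis by (rule that)
qed

section \<open>Aperiodicity of the tilings\<close>

lemma card_square_eq_square_sum:
  "real (card {z \<in> square (p, q) n. P (fst z) (snd z)}) = square_sum (\<lambda>x y. of_bool (P x y)) p q n"
proof -
  let ?S = "{p..<p+int n} \<times> {q..<q+int n}"
  have "real (card {z \<in> square (p, q) n. P (fst z) (snd z)}) =
      (\<Sum>z\<in>?S. of_bool (P (fst z) (snd z)))"
    by (simp add: square_def Int_def)
  also have "\<dots> = square_sum (\<lambda>x y. of_bool (P x y)) p q n"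
    unfolding square_sum_def sum.cartesian_product by (simp only: split_def)
  finally show ?thesis .
qed

lemma card_square: "card (square p n) = n\<^sup>2"
  by (simp add: square_def power2_eq_square)

lemma square_sum_mono: "(\<And>x y. f x y \<le> h x y) \<Longrightarrow> square_sum f p q n \<le> square_sum h p q n"
  unfolding square_sum_def by (intro sum_mono)

lemma mismatch_density_tiles:
  assumes "tiling tiles V" "(s, t) \<noteq> (0, 0)"
  shows "\<exists>C. \<forall>p q n. (real n)\<^sup>2 / 4 - C * real n \<le>
    square_sum (\<lambda>x y. of_bool (V (x, y) \<noteq> V (x + s, y + t))) p q n"
proof -
  obtain c r r' where c: "leaf_bits c"
    and ne: "\<And>x y t u. odd t \<or> odd u \<Longrightarrow> V (x, y) \<noteq> V (x + t, y + u)"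
    and block: "\<And>m n i j. i \<in> {0, 1} \<Longrightarrow> j \<in> {0, 1} \<Longrightarrow> block_bit (V (2*m+r+i, 2*n+r'+j)) = c m n"
    using tiling_tilesE[OF assms(1)] by metis
  show ?thesis
  proof (cases "odd s \<or> odd t")
    case True
    then have "square_sum (\<lambda>x y. of_bool (V (x, y) \<noteq> V (x + s, y + t))) p q n = (real n)\<^sup>2" for p q n
      using ne by (simp add: square_sum_def power2_eq_square)
    then show ?thesis by (intro exI[of _ 0]) simp
  next
    case False
    then obtain s' t' where st: "s = 2*s'" "t = 2*t'" by blast
    then have "mismatch_density s' t' (1/4) (3/4)"
      using assms(2) mismatch_density by simp
    then obtain C where C: "\<And>p q n. 1/4 * (real n)\<^sup>2 - C * real n \<le> square_sum (mismatch c s' t') p q n"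
      using c unfolding mismatch_density_def by blast
    define f :: "int \<Rightarrow> int \<Rightarrow> real"
      where "f x y = of_bool (block_bit (V (x, y)) \<noteq> block_bit (V (x + s, y + t)))" for x y
    \<comment> \<open>\<open>4 * \<bar>C\<bar>\<close> comes from the four sublattices, 4 from
      splitting the square and 1 from \<open>k^2 \<ge> n^2/4 - n\<close>.\<close>
    have "(real n)\<^sup>2 / 4 - (4 * \<bar>C\<bar> + 5) * real n \<le>
        square_sum (\<lambda>x y. of_bool (V (x, y) \<noteq> V (x + s, y + t))) p q n" for p q n
    proof -
      define k where "k = n div 2"
      have f_child: "f (2*x+r+i) (2*y+r'+j) = mismatch c s' t' x y"
        if "i \<in> {0, 1}" "j \<in> {0, 1}" for x y i j
        using block[OF that, of x y] block[OF that, of "x+s'" "y+t'"]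
        by (simp add: f_def mismatch_def st algebra_simps)
      obtain p' q' where "\<bar>square_sum f p q n - (\<Sum>i\<in>{0,1}. \<Sum>j\<in>{0,1}.
          square_sum (\<lambda>x y. f (2*x+r+i) (2*y+r'+j)) p' q' k)\<bar> \<le> 4 * real n"
        using square_sum_halved[of f p q n r r'] unfolding k_def by (auto simp: f_def)
      also have "(\<Sum>i\<in>{0,1}. \<Sum>j\<in>{0,1}. square_sum (\<lambda>x y. f (2*x+r+i) (2*y+r'+j)) p' q' k) =
          (\<Sum>i\<in>{0,1::int}. \<Sum>j\<in>{0,1::int}. square_sum (mismatch c s' t') p' q' k)"
        by (intro sum.cong refl) (simp only: f_child)
      finally have "4 * square_sum (mismatch c s' t') p' q' k - 4 * real n \<le> square_sum f p q n"
        by (simp add: abs_le_iff)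
      moreover have "(real n)\<^sup>2 / 4 - real n \<le> (real k)\<^sup>2"
      proof -
        have "n = 2 * k \<or> n = 2 * k + 1" unfolding k_def by presburger
        then show ?thesis by (auto simp: power2_eq_square field_simps)
      qed
      moreover have "C * real k \<le> \<bar>C\<bar> * real n"
        unfolding k_def by (intro mult_mono) auto
      moreover have "square_sum f p q n \<le>
          square_sum (\<lambda>x y. of_bool (V (x, y) \<noteq> V (x + s, y + t))) p q n"
        by (rule square_sum_mono) (auto simp: f_def)
      ultimately show ?thesis
        using C[of k p' q'] by (simp add: algebra_simps)
    qed
    then show ?thesis by blast
  qed
qed

lemma tiles_aperiodic:
  assumes "tiling tiles V" "\<alpha> < 1/4"
  shows "aperiodic \<alpha> V"
  unfolding aperiodic_def
proof (intro allI impI)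
  fix T :: "int \<times> int"
  assume "T \<noteq> (0, 0)"
  then obtain C where C: "\<And>p q n. (real n)\<^sup>2 / 4 - C * real n \<le>
      square_sum (\<lambda>x y. of_bool (V (x, y) \<noteq> V (x + fst T, y + snd T))) p q n"
    using mismatch_density_tiles[OF assms(1), of "fst T" "snd T"] by (auto simp: prod_eq_iff)
  \<comment> \<open>Beyond \<open>N\<close> the boundary term \<open>C * n\<close> is below
    \<open>(1/4 - \<alpha>) * n^2\<close>; the maximum with 0 also forces
    \<open>n > 0\<close>.\<close>
  obtain N where N: "max 0 C / (1/4 - \<alpha>) < real N"
    using reals_Archimedean2 by blast
  have "\<alpha> * real (card (square p n)) <
      real (card {x \<in> square p n. V x \<noteq> V (fst x + fst T, snd x + snd T)})" if "N \<le> n" for n p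
  proof -
    have "max 0 C / (1/4 - \<alpha>) < real n"
      using N that by linarith
    then have "max 0 C < (1/4 - \<alpha>) * real n"
      using assms(2) by (simp add: pos_divide_less_eq mult.commute)
    moreover from this have "0 < real n"
      using assms(2) by (smt (verit) mult_nonneg_nonpos of_nat_0_le_iff zero_less_mult_iff)
    ultimately have "C * real n < (1/4 - \<alpha>) * real n * real n"
      by (intro mult_strict_right_mono) auto
    then have "\<alpha> * (real n)\<^sup>2 < (real n)\<^sup>2 / 4 - C * real n"
      by (simp add: power2_eq_square algebra_simps)
    moreover have "{x \<in> square p n. V x \<noteq> V (fst x + fst T, snd x + snd T)} =
        {z \<in> square (fst p, snd p) n. V (fst z, snd z) \<noteq> V (fst z + fst T, snd z + snd T)}"
      by simp
    ultimately show ?thesis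
      using C[of n "fst p" "snd p"]
        card_square_eq_square_sum[of "fst p" "snd p" n "\<lambda>x y. V (x, y) \<noteq> V (x + fst T, y + snd T)"]
      by (simp add: card_square)
  qed
  then show "\<exists>N. \<forall>n\<ge>N. \<forall>p. \<alpha> * real (card (square p n)) <
      real (card {x \<in> square p n. V x \<noteq> V (fst x + fst T, snd x + snd T)})"
    by blast
qed

text \<open>Applying \<open>h\<close> can only lose mismatches.\<close>

lemma aperiodic_comp:
  assumes "aperiodic \<alpha> (h \<circ> U)"
  shows "aperiodic \<alpha> U"
  unfolding aperiodic_def
proof (intro allI impI)
  fix T :: "int \<times> int"
  assume "T \<noteq> (0, 0)"
  then obtain N where N: "\<And>n p. N \<le> n \<Longrightarrow> \<alpha> * real (card (square p n)) <
      real (card {x \<in> square p n. (h \<circ> U) x \<noteq> (h \<circ> U) (fst x + fst T, snd x + snd T)})"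
    using assms unfolding aperiodic_def by blast
  have "card {x \<in> square p n. (h \<circ> U) x \<noteq> (h \<circ> U) (fst x + fst T, snd x + snd T)} \<le>
      card {x \<in> square p n. U x \<noteq> U (fst x + fst T, snd x + snd T)}" for n p
    by (rule card_mono) (auto simp: square_def)
  then show "\<exists>N. \<forall>n\<ge>N. \<forall>p. \<alpha> * real (card (square p n)) <
      real (card {x \<in> square p n. U x \<noteq> U (fst x + fst T, snd x + snd T)})"
    using N by (meson less_le_trans of_nat_le_iff)
qed

theorem mainTheorem5:
  shows "\<exists>\<tau> :: nat tile set. tile_set \<tau> \<and> (\<exists>U. tiling \<tau> U) \<and>
           (\<forall>U. tiling \<tau> U \<longrightarrow> (\<forall>\<alpha>. \<alpha> < 1/4 \<longrightarrow> aperiodic \<alpha> U))"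
proof (rule exI[of _ "map_tile to_nat ` tiles"], intro conjI allI impI)
  show "tile_set (map_tile (to_nat :: colour \<Rightarrow> nat) ` tiles)"
    unfolding tile_set_def by (intro finite_imageI finite_tiles)
  show "\<exists>U. tiling (map_tile (to_nat :: colour \<Rightarrow> nat) ` tiles) U"
    using tiling_tiles_exists tiling_map_tile by blast
  fix U :: "int \<times> int \<Rightarrow> nat tile" and \<alpha> :: real
  assume "tiling (map_tile (to_nat :: colour \<Rightarrow> nat) ` tiles) U" "\<alpha> < 1/4"
  then show "aperiodic \<alpha> U"
    by (intro aperiodic_comp[of _ "map_tile (inv (to_nat :: colour \<Rightarrow> nat))"] tiles_aperiodic tiling_map_tile_inv inj_to_nat)
qed

end
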